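(* Let $A\in\mathbb{R}^{m\times n}$, $b\in\mathbb{R}^m$, $p=1$, and let $\phi:\mathbb{R}_+\to\mathbb{R}_+$ be continuous and nondecreasing with $\phi(0)=0$. Let $L$, $s_i,\rho_i,\Omega_i$ ($i\in\mathbb{N}_L^0$) and $K$, $\Lambda_i$ ($i=-1,0,\dots,K-1$), $t_i,\lambda_i$ ($i\in\mathbb{N}_K^0$) be produced by Iterations 1 and 2 of the context. Let $\lambda_{-1}:=+\infty$. For $\lambda>0$ let $\Omega(\lambda)$ be the set of all global minimizers of $$\min\{\|x\|_0+\lambda\phi(\|Ax-b\|_1):x\in\mathbb{R}^n\},\qquad(P_\lambda)$$ and for $\sigma\ge\min\{\|Ax-b\|_1:x\in\mathbb{R}^n\}$ let $\widehat\Omega(\sigma)$ be the set of all global minimizers of $$\min\{\|x\|_0:\|Ax-b\|_1\le\sigma,\ x\in\mathbb{R}^n\}.\qquad(C_\sigma)$$ Then: (i) $\widehat\Omega(\sigma)=\Omega(\lambda)=\{\mathbf{0}_n\}$ for $\sigma\ge\|b\|_1$ and $0<\lambda<\lambda_{K-1}$. (ii) For $k=K-1$ with $s_{t_k}\ge 2$, or $k\le K-2$ (where $k\ge 0$ is an integer): if there exists $x^*\in\Omega_{t_k}$ such that $\|Ax^*-b\|_0\ge m+2-s_{t_k}$, then $\sharp\Omega(\lambda)=+\infty$ for any $\lambda\in[\lambda_k,\lambda_{k-1})$, and $x^*$ is not a strict minimizer of problem $(P_\lambda)$ for such $\lambda$. (iii) Suppose $\phi(z)=z$ for $z\ge 0$.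 Then $\sharp\widehat\Omega(\sigma)=+\infty$ for all $\sigma\in(\rho_k,\rho_{k+1})$, $k\in\mathbb{N}_{L-1}^0$. Further, for $\sigma=\rho_k$ and $k\ge 0$ satisfying $k=K-1$ with $s_k\ge 2$, or $k\le K-2$: if there exists $x^*\in\Omega_k$ such that $\|Ax^*-b\|_0\ge m+2-s_k$, then $\sharp\widehat\Omega(\sigma)=+\infty$, and $x^*$ is not a strict minimizer of problem $(C_\sigma)$.
   Context: $\mathbb{R}_+=[0,+\infty)$; $\mathbb{N}_k^0=\{0,1,\dots,k\}$ (with $\mathbb{N}_{-1}^0=\emptyset$); $\sharp S$ is the cardinality of $S$; $\|x\|_0$ is the number of nonzero components of a vector $x$ (of any dimension); $\mathbf{0}_n$ is the zero vector of $\mathbb{R}^n$; $\arg\min$, $\arg\max$ denote the sets of all global minimizers/maximizers. For $x\in\mathbb{R}^d$ and $\delta>0$, $U(x;\delta):=\{x'\in\mathbb{R}^d:\|x-x'\|_2\le\delta\}$. For $g:\mathbb{R}^d\to\mathbb{R}$ and $S\subseteq\mathbb{R}^d$, $\hat x$ is a strict minimizer of $\min\{g(x):x\in S\}$ if there exists $\delta>0$ such that $g(x)>g(\hat x)$ for every $x\in U(\hat x;\delta)\cap S$ with $x\ne\hat x$. Iteration 1 (depending on $A,b,p,\phi$). Set $i=0$ and $\rho_0:=\min\{\phi(\|Ax-b\|_p):x\in\mathbb{R}^n\}$, $s_0:=\min\{\|x\|_0:\phi(\|Ax-b\|_p)=\rho_0,\ x\in\mathbb{R}^n\}$, $\Omega_0:=\arg\min\{\|x\|_0:\phi(\|Ax-b\|_p)=\rho_0,\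 x\in\mathbb{R}^n\}$. While $s_i>0$: put $\rho_{i+1}:=\min\{\phi(\|Ax-b\|_p):\|x\|_0\le s_i-1,\ x\in\mathbb{R}^n\}$, $s_{i+1}:=\min\{\|x\|_0:\phi(\|Ax-b\|_p)=\rho_{i+1},\ x\in\mathbb{R}^n\}$, $\Omega_{i+1}:=\arg\min\{\|x\|_0:\phi(\|Ax-b\|_p)=\rho_{i+1},\ x\in\mathbb{R}^n\}$, and replace $i$ by $i+1$. When the loop ends (i.e. $s_i=0$), set $L:=i$. (All these minima are attained and the iteration terminates.) Iteration 2. Set $i=0$ and $\Lambda_{-1}:=\{0\}$. While $L\notin\Lambda_{i-1}$: put $t_i:=\max\Lambda_{i-1}$, $\lambda_i:=\max\{\frac{s_{t_i}-s_j}{\rho_j-\rho_{t_i}}:j=t_i+1,\dots,L\}$, $\Lambda_i:=\arg\max\{\frac{s_{t_i}-s_j}{\rho_j-\rho_{t_i}}:j=t_i+1,\dots,L\}$ (a set of indices $j$), and replace $i$ by $i+1$. When the loop ends, set $K:=i$, $t_K:=L$, $\lambda_K:=0$. *)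

theory Defs
  imports "HOL-Analysis.Analysis"
begin

definition l0 :: "real ^ 'd \<Rightarrow> nat" where
  "l0 x = card {i. x $ i \<noteq> 0}"

definition l1_norm :: "real ^ 'd \<Rightarrow> real" where
  "l1_norm x = (\<Sum>i\<in>UNIV. \<bar>x $ i\<bar>)"

text \<open>The minimum value of \<open>f\<close> over \<open>S\<close>. For a linear order, \<open>LEAST v. v \<in> V\<close> is the
  element of \<open>V\<close> that is below all elements of \<open>V\<close>, so unlike \<open>Inf\<close> it is meaningful only
  when the minimum is attained.\<close>

definition min_value :: "('a \<Rightarrow> 'b::linorder) \<Rightarrow> 'a set \<Rightarrow> 'b" where
  "min_value f S = (LEAST v. v \<in> f ` S)"

definition argmin_set :: "('a \<Rightarrow> 'b::linorder) \<Rightarrow> 'a set \<Rightarrow> 'a set" where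
  "argmin_set f S = {x. is_arg_min f (\<lambda>x. x \<in> S) x}"

definition argmax_set :: "('a \<Rightarrow> 'b::linorder) \<Rightarrow> 'a set \<Rightarrow> 'a set" where
  "argmax_set f S = {x. is_arg_max f (\<lambda>x. x \<in> S) x}"

definition strict_minimizer :: "(real ^ 'd \<Rightarrow> real) \<Rightarrow> (real ^ 'd) set \<Rightarrow> real ^ 'd \<Rightarrow> bool" where
  "strict_minimizer g S y \<longleftrightarrow> (\<exists>\<delta>>0. \<forall>x \<in> cball y \<delta> \<inter> S. x \<noteq> y \<longrightarrow> g x > g y)"


section \<open>The optimization problems\<close>

definition loss :: "real ^ 'n ^ 'm \<Rightarrow> real ^ 'm \<Rightarrow> (real \<Rightarrow> real) \<Rightarrow> real ^ 'n \<Rightarrow> real" where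
  "loss A b \<phi> x = \<phi> (l1_norm (A *v x - b))"

definition P_obj :: "real ^ 'n ^ 'm \<Rightarrow> real ^ 'm \<Rightarrow> (real \<Rightarrow> real) \<Rightarrow> real \<Rightarrow> real ^ 'n \<Rightarrow> real" where
  "P_obj A b \<phi> \<mu> x = real (l0 x) + \<mu> * loss A b \<phi> x"

definition P_sol :: "real ^ 'n ^ 'm \<Rightarrow> real ^ 'm \<Rightarrow> (real \<Rightarrow> real) \<Rightarrow> real \<Rightarrow> (real ^ 'n) set" where
  "P_sol A b \<phi> \<mu> = argmin_set (P_obj A b \<phi> \<mu>) UNIV"

definition C_feas :: "real ^ 'n ^ 'm \<Rightarrow> real ^ 'm \<Rightarrow> real \<Rightarrow> (real ^ 'n) set" where
  "C_feas A b \<sigma> = {x. l1_norm (A *v x - b) \<le> \<sigma>}"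

definition C_sol :: "real ^ 'n ^ 'm \<Rightarrow> real ^ 'm \<Rightarrow> real \<Rightarrow> (real ^ 'n) set" where
  "C_sol A b \<sigma> = argmin_set l0 (C_feas A b \<sigma>)"


section \<open>Iteration 1\<close>

definition level_set :: "real ^ 'n ^ 'm \<Rightarrow> real ^ 'm \<Rightarrow> (real \<Rightarrow> real) \<Rightarrow> real \<Rightarrow> (real ^ 'n) set" where
  "level_set A b \<phi> r = {x. loss A b \<phi> x = r}"

text \<open>The sequences below are total functions on \<open>nat\<close>; their values beyond the last index
  reached by the loop (\<open>itL\<close>, resp. \<open>itK\<close>) have no meaning. In \<open>rho\<close>, the inner
  \<open>min_value l0 (level_set A b \<phi> (rho A b \<phi> i))\<close> is \<open>s_it A b \<phi> i\<close>; it is positive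
  whenever the loop body is executed, so the truncated subtraction is harmless.\<close>

primrec rho :: "real ^ 'n ^ 'm \<Rightarrow> real ^ 'm \<Rightarrow> (real \<Rightarrow> real) \<Rightarrow> nat \<Rightarrow> real" where
  "rho A b \<phi> 0 = min_value (loss A b \<phi>) UNIV"
| "rho A b \<phi> (Suc i) =
     min_value (loss A b \<phi>) {x. l0 x \<le> min_value l0 (level_set A b \<phi> (rho A b \<phi> i)) - 1}"

definition s_it :: "real ^ 'n ^ 'm \<Rightarrow> real ^ 'm \<Rightarrow> (real \<Rightarrow> real) \<Rightarrow> nat \<Rightarrow> nat" where
  "s_it A b \<phi> i = min_value l0 (level_set A b \<phi> (rho A b \<phi> i))"

definition Omega :: "real ^ 'n ^ 'm \<Rightarrow> real ^ 'm \<Rightarrow> (real \<Rightarrow> real) \<Rightarrow> nat \<Rightarrow> (real ^ 'n) set" where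
  "Omega A b \<phi> i = argmin_set l0 (level_set A b \<phi> (rho A b \<phi> i))"

definition itL :: "real ^ 'n ^ 'm \<Rightarrow> real ^ 'm \<Rightarrow> (real \<Rightarrow> real) \<Rightarrow> nat" where
  "itL A b \<phi> = (LEAST i. s_it A b \<phi> i = 0)"


section \<open>Iteration 2\<close>

definition ratio :: "real ^ 'n ^ 'm \<Rightarrow> real ^ 'm \<Rightarrow> (real \<Rightarrow> real) \<Rightarrow> nat \<Rightarrow> nat \<Rightarrow> real" where
  "ratio A b \<phi> t j = (real (s_it A b \<phi> t) - real (s_it A b \<phi> j)) / (rho A b \<phi> j - rho A b \<phi> t)"

text \<open>The index of \<open>Lam\<close> is shifted by one: \<open>Lam A b \<phi> i\<close> is the set \<open>\<Lambda>\<close> with index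
  \<open>i - 1\<close>, so that \<open>Lam A b \<phi> 0\<close> is the initial set \<open>{0}\<close> with index \<open>-1\<close>.\<close>

primrec Lam :: "real ^ 'n ^ 'm \<Rightarrow> real ^ 'm \<Rightarrow> (real \<Rightarrow> real) \<Rightarrow> nat \<Rightarrow> nat set" where
  "Lam A b \<phi> 0 = {0}"
| "Lam A b \<phi> (Suc i) =
     argmax_set (ratio A b \<phi> (Max (Lam A b \<phi> i))) {Max (Lam A b \<phi> i) + 1..itL A b \<phi>}"

definition itK :: "real ^ 'n ^ 'm \<Rightarrow> real ^ 'm \<Rightarrow> (real \<Rightarrow> real) \<Rightarrow> nat" where
  "itK A b \<phi> = (LEAST i. itL A b \<phi> \<in> Lam A b \<phi> i)"

definition t_it :: "real ^ 'n ^ 'm \<Rightarrow> real ^ 'm \<Rightarrow> (real \<Rightarrow> real) \<Rightarrow> nat \<Rightarrow> nat" where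
  "t_it A b \<phi> i = (if i < itK A b \<phi> then Max (Lam A b \<phi> i) else itL A b \<phi>)"

text \<open>Unlike \<open>Lam\<close>, \<open>lam\<close> carries its original index, which ranges over \<open>-1, 0, \<dots>, K\<close>.\<close>

definition lam :: "real ^ 'n ^ 'm \<Rightarrow> real ^ 'm \<Rightarrow> (real \<Rightarrow> real) \<Rightarrow> int \<Rightarrow> ereal" where
  "lam A b \<phi> k =
     (if k < 0 then \<infinity>
      else if k < int (itK A b \<phi>)
        then ereal (Max (ratio A b \<phi> (t_it A b \<phi> (nat k)) ` {t_it A b \<phi> (nat k) + 1..itL A b \<phi>}))
      else 0)"

end

theory Submission
  imports Defs
begin

text \<open>The pairs \<open>(\<rho>\<^sub>j, s\<^sub>j)\<close> are the Pareto front of \<open>(loss x, l0 x)\<close>, and Iteration 2 walks along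
  the vertices of its lower convex hull, with slopes \<open>-\<lambda>\<^sub>i\<close>. Hence the points of \<open>\<Omega>\<close> with index
  \<open>t\<^sub>k\<close> solve the penalized problem for \<open>\<lambda>\<^sub>k \<le> \<mu> < \<lambda>\<^sub>k\<^sub>-\<^sub>1\<close>. A solution with enough nonzero residuals
  can be moved along a direction within its support that keeps the vanishing residuals at zero
  and, to first order, the \<open>l1\<close> norm of the residual unchanged. As that norm is affine as long as
  no sign changes, short steps preserve both objectives.\<close>

section \<open>Attained minima\<close>

lemma argmin_set_iff: "x \<in> argmin_set f S \<longleftrightarrow> x \<in> S \<and> (\<forall>y\<in>S. f x \<le> f y)"
  by (auto simp: argmin_set_def is_arg_min_linorder)

lemma argmax_set_iff:
  fixes f :: "'a \<Rightarrow> 'b::linorder"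
  shows "x \<in> argmax_set f S \<longleftrightarrow> x \<in> S \<and> (\<forall>y\<in>S. f y \<le> f x)"
  by (auto simp: argmax_set_def is_arg_max_linorder)

lemma min_value_eq: "x \<in> argmin_set f S \<Longrightarrow> min_value f S = f x"
  unfolding min_value_def by (rule Least_equality) (auto simp: argmin_set_iff)

lemma argmin_set_nat_nonempty:
  fixes f :: "'a \<Rightarrow> nat"
  assumes "S \<noteq> {}"
  shows "argmin_set f S \<noteq> {}"
proof -
  obtain x where "x \<in> S" "\<forall>y. y \<in> S \<longrightarrow> f x \<le> f y"
    using ex_has_least_nat[of "\<lambda>x. x \<in> S" _ f] assms by blast
  then have "x \<in> argmin_set f S" by (simp add: argmin_set_iff)
  then show ?thesis by blast
qed

lemma argmax_set_finite_nonempty: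
  fixes f :: "'a \<Rightarrow> 'b::linorder"
  assumes "finite S" "S \<noteq> {}"
  shows "argmax_set f S \<noteq> {}"
proof -
  have "Max (f ` S) \<in> f ` S" using assms by (intro Max_in) auto
  then obtain x where "x \<in> S" "f x = Max (f ` S)" by (metis imageE)
  then have "x \<in> argmax_set f S" using assms by (simp add: argmax_set_iff)
  then show ?thesis by blast
qed

section \<open>Sparsity, the \<open>l1\<close> norm and the existence of nearest points\<close>

lemma l0_zero [simp]: "l0 0 = 0"
  by (simp add: l0_def)

lemma l0_eq_0_iff [simp]: "l0 x = 0 \<longleftrightarrow> x = 0"
  by (auto simp: l0_def vec_eq_iff)

lemma l1_norm_nonneg: "l1_norm x \<ge> 0"
  by (simp add: l1_norm_def sum_nonneg)

lemma norm_le_l1_norm: "norm x \<le> l1_norm x"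
  unfolding l1_norm_def by (rule norm_le_l1_cart)

text \<open>Cutting \<open>V\<close> down to the sublevel set through \<open>v0\<close> loses no
  minimizer and makes it compact: the \<open>l1\<close> norm dominates the Euclidean one, so the
  sublevel set is bounded.\<close>

lemma l1_distance_attained:
  fixes V :: "(real ^ 'm) set"
  assumes "closed V" "v0 \<in> V"
  shows "\<exists>v\<in>V. \<forall>w\<in>V. l1_norm (v - b) \<le> l1_norm (w - b)"
proof -
  define K where "K = V \<inter> {v. l1_norm (v - b) \<le> l1_norm (v0 - b)}"
  have cont: "continuous_on S (\<lambda>v. l1_norm (v - b))" for S
    unfolding l1_norm_def by (intro continuous_intros)
  have "closed {v. l1_norm (v - b) \<le> l1_norm (v0 - b)}"
    by (intro closed_Collect_le cont continuous_intros)
  then have "closed K" unfolding K_def using assms by blast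
  moreover have "K \<subseteq> cball b (l1_norm (v0 - b))"
    unfolding K_def
    by (auto simp: dist_norm norm_minus_commute[of b] intro: order_trans[OF norm_le_l1_norm])
  ultimately have "compact K"
    using bounded_subset[OF bounded_cball] compact_eq_bounded_closed by blast
  moreover have "v0 \<in> K" using assms by (simp add: K_def)
  ultimately obtain v where v: "v \<in> K" "\<forall>w\<in>K. l1_norm (v - b) \<le> l1_norm (w - b)"
    using continuous_attains_inf[OF _ _ cont] by (metis empty_iff)
  show ?thesis
  proof (intro bexI ballI)
    show "v \<in> V" using v by (simp add: K_def)
    fix w assume "w \<in> V"
    then show "l1_norm (v - b) \<le> l1_norm (w - b)"
      using v unfolding K_def by (cases "w \<in> K") (auto simp: K_def)
  qed
qed

text \<open>Sparse vectors form a finite union of coordinate subspaces, and a linear map sends each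
  of these to a subspace, which is closed. Passing to the image matters because sublevel sets of the
  residual norm may be unbounded in \<open>x\<close>.\<close>

lemma closed_image_sparse:
  fixes A :: "real ^ 'n ^ 'm"
  shows "closed ((\<lambda>x. A *v x) ` {x. l0 x \<le> k})"
proof -
  have "{x::real^'n. l0 x \<le> k} = (\<Union>S\<in>{S. card S \<le> k}. {x. \<forall>i. i \<notin> S \<longrightarrow> x $ i = 0})"
    (is "?L = ?R")
  proof
    show "?L \<subseteq> ?R" by (force simp: l0_def)
    show "?R \<subseteq> ?L"
    proof
      fix x assume "x \<in> ?R"
      then obtain S where S: "card S \<le> k" "\<forall>i. i \<notin> S \<longrightarrow> x $ i = 0" by auto
      then have "card {i. x $ i \<noteq> 0} \<le> card S" by (intro card_mono) auto
      then show "x \<in> ?L" using S by (simp add: l0_def)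
    qed
  qed
  then have "(\<lambda>x. A *v x) ` {x. l0 x \<le> k} =
      (\<Union>S\<in>{S. card S \<le> k}. (\<lambda>x. A *v x) ` {x. \<forall>i. i \<notin> S \<longrightarrow> x $ i = 0})"
    by (simp add: image_UN)
  moreover have "closed ((\<lambda>x. A *v x) ` {x. \<forall>i. i \<notin> S \<longrightarrow> x $ i = 0})" for S
    by (intro closed_subspace linear_subspace_image matrix_vector_mul_linear)
      (auto simp: subspace_def)
  ultimately show ?thesis by auto
qed

section \<open>Moving along a direction\<close>

text \<open>The first conclusion yields infinitely many minimizers, the second refutes strictness of
  a minimizer.\<close>

lemma infinite_ray:
  fixes x d :: "'a::real_normed_vector"
  assumes "d \<noteq> 0" and ev: "\<forall>\<^sub>F t in at_right 0. x + t *\<^sub>R d \<in> S"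
  shows "infinite S" "\<delta> > 0 \<Longrightarrow> \<exists>y \<in> cball x \<delta> \<inter> S. y \<noteq> x"
proof -
  obtain e where e: "e > 0" "\<And>t. 0 < t \<Longrightarrow> t < e \<Longrightarrow> x + t *\<^sub>R d \<in> S"
    using ev unfolding eventually_at_right_field by auto
  have "inj_on (\<lambda>t. x + t *\<^sub>R d) {0<..<e}" using assms by (auto simp: inj_on_def)
  then have "infinite ((\<lambda>t. x + t *\<^sub>R d) ` {0<..<e})"
    using finite_imageD e(1) infinite_Ioo by blast
  moreover have "(\<lambda>t. x + t *\<^sub>R d) ` {0<..<e} \<subseteq> S" using e by auto
  ultimately show "infinite S" using finite_subset by blast
  assume "\<delta> > 0"
  \<comment> \<open>\<open>e / 2\<close> keeps the point in \<open>S\<close>,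
    \<open>\<delta> / norm d\<close> keeps it in the ball.\<close>
  define t where "t = min (e / 2) (\<delta> / norm d)"
  have t: "0 < t" "t < e" "t \<le> \<delta> / norm d" using \<open>\<delta> > 0\<close> e assms by (auto simp: t_def)
  then have "dist x (x + t *\<^sub>R d) \<le> \<delta>" using assms by (simp add: dist_norm field_simps)
  then show "\<exists>y \<in> cball x \<delta> \<inter> S. y \<noteq> x"
    using t e assms by (intro bexI[of _ "x + t *\<^sub>R d"]) auto
qed

lemma not_strict_minimizer_ray:
  assumes "d \<noteq> 0" and "\<forall>\<^sub>F t in at_right 0. x + t *\<^sub>R d \<in> S \<and> g (x + t *\<^sub>R d) \<le> g x"
  shows "\<not> strict_minimizer g S x"
proof
  assume "strict_minimizer g S x"
  then obtain \<delta> where \<delta>: "\<delta> > 0" "\<And>y. y \<in> cball x \<delta> \<inter> S \<Longrightarrow> y \<noteq> x \<Longrightarrow> g x < g y"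
    unfolding strict_minimizer_def by auto
  have "\<forall>\<^sub>F t in at_right 0. x + t *\<^sub>R d \<in> {y \<in> S. g y \<le> g x}" using assms(2) by simp
  from infinite_ray(2)[OF assms(1) this \<delta>(1)]
  obtain y where "y \<in> cball x \<delta> \<inter> S" "y \<noteq> x" "g y \<le> g x" by blast
  with \<delta>(2) show False by (simp add: not_le[symmetric])
qed

lemma eventually_sgn_add:
  fixes r q :: real
  assumes "r \<noteq> 0"
  shows "\<forall>\<^sub>F t in at_right 0. sgn (r + t * q) = sgn r"
proof -
  have lim: "((\<lambda>t. r + t * q) \<longlongrightarrow> r) (at_right 0)"
    by (auto intro!: tendsto_eq_intros)
  show ?thesis
  proof (cases "r > 0")
    case True
    then show ?thesis using order_tendstoD(1)[OF lim True]
      by (auto elim!: eventually_mono)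
  next
    case False
    then have "r < 0" using assms by simp
    then show ?thesis using order_tendstoD(2)[OF lim, of 0]
      by (auto elim!: eventually_mono)
  qed
qed

text \<open>A direction within the support of \<open>x\<close> creates no new nonzero entry, and a
  short step annihilates none.\<close>

lemma eventually_l0_add:
  fixes x d :: "real ^ 'n"
  assumes "\<And>i. x $ i = 0 \<Longrightarrow> d $ i = 0"
  shows "\<forall>\<^sub>F t in at_right 0. l0 (x + t *\<^sub>R d) = l0 x"
proof -
  have "\<forall>\<^sub>F t in at_right 0. \<forall>i. sgn (x $ i + t * d $ i) = sgn (x $ i)"
  proof (rule eventually_all_finite)
    fix i show "\<forall>\<^sub>F t in at_right 0. sgn (x $ i + t * d $ i) = sgn (x $ i)"
      using assms[of i] eventually_sgn_add[of "x $ i" "d $ i"] by (cases "x $ i = 0") auto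
  qed
  then show ?thesis
  proof (rule eventually_mono)
    fix t assume *: "\<forall>i. sgn (x $ i + t * d $ i) = sgn (x $ i)"
    have "x $ i + t * d $ i = 0 \<longleftrightarrow> x $ i = 0" for i
      using *[rule_format, of i] by (metis sgn_0_0)
    then show "l0 (x + t *\<^sub>R d) = l0 x" by (simp add: l0_def)
  qed
qed

lemma eventually_l1_norm_add:
  fixes r q :: "real ^ 'm"
  assumes "\<And>i. r $ i = 0 \<Longrightarrow> q $ i = 0" and "(\<Sum>i\<in>UNIV. sgn (r $ i) * q $ i) = 0"
  shows "\<forall>\<^sub>F t in at_right 0. l1_norm (r + t *\<^sub>R q) = l1_norm r"
proof -
  have "\<forall>\<^sub>F t in at_right 0. \<forall>i. sgn (r $ i + t * q $ i) = sgn (r $ i)"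
  proof (rule eventually_all_finite)
    fix i show "\<forall>\<^sub>F t in at_right 0. sgn (r $ i + t * q $ i) = sgn (r $ i)"
      using assms(1)[of i] eventually_sgn_add[of "r $ i" "q $ i"] by (cases "r $ i = 0") auto
  qed
  then show ?thesis
  proof (rule eventually_mono)
    fix t assume *: "\<forall>i. sgn (r $ i + t * q $ i) = sgn (r $ i)"
    \<comment> \<open>Since \<open>\<bar>y\<bar> = y * sgn y\<close>, an absolute value is affine in
      \<open>t\<close> while the sign is fixed.\<close>
    have "\<bar>r $ i + t * q $ i\<bar> = \<bar>r $ i\<bar> + t * (sgn (r $ i) * q $ i)" for i
      using *[rule_format, of i] abs_sgn[of "r $ i + t * q $ i"] abs_sgn[of "r $ i"]
      by (simp add: algebra_simps)
    then have "l1_norm (r + t *\<^sub>R q) = l1_norm r + t * (\<Sum>i\<in>UNIV. sgn (r $ i) * q $ i)"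
      by (simp add: l1_norm_def sum.distrib sum_distrib_left)
    then show "l1_norm (r + t *\<^sub>R q) = l1_norm r" using assms by simp
  qed
qed

text \<open>The orthogonal projections of \<open>B\<close> to the vectors supported in
  \<open>S\<close> span a proper subspace by counting dimensions, so some nonzero vector there is
  orthogonal to all of them. On such vectors \<open>a\<close> and its projection have the same inner
  product.\<close>

lemma ex_orthogonal_in_coordinate_subspace:
  fixes B :: "(real ^ 'n) set"
  assumes "finite B" "card B < card S"
  shows "\<exists>d. d \<noteq> 0 \<and> (\<forall>j. j \<notin> S \<longrightarrow> d $ j = 0) \<and> (\<forall>a\<in>B. a \<bullet> d = 0)"
proof -
  define V :: "(real ^ 'n) set" where "V = {x. \<forall>j. j \<notin> S \<longrightarrow> x $ j = 0}"
  define \<pi> :: "real ^ 'n \<Rightarrow> real ^ 'n" where "\<pi> a = (\<chi> j. if j \<in> S then a $ j else 0)" for a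
  have V: "subspace V" by (auto simp: subspace_def V_def)
  have "\<pi> ` B \<subseteq> V" by (auto simp: \<pi>_def V_def)
  then have sub: "span (\<pi> ` B) \<subseteq> V" using V by (simp add: span_minimal)
  have "dim (span (\<pi> ` B)) \<le> card (\<pi> ` B)" using assms by (simp add: dim_le_card')
  also have "\<dots> \<le> card B" using assms by (simp add: card_image_le)
  also have "\<dots> < dim V" using assms dim_substandard_cart[of S, where 'a = real]
    by (simp add: V_def dim_vec_eq)
  finally have "span (\<pi> ` B) \<noteq> V" by auto
  then have "span (\<pi> ` B) \<subset> span V" using sub V by (simp add: psubset_eq span_eq_iff[THEN iffD2])
  then obtain d where d: "d \<noteq> 0" "d \<in> span V" "\<And>y. y \<in> span (\<pi> ` B) \<Longrightarrow> orthogonal d y"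
    using orthogonal_to_subspace_exists_gen by blast
  have dV: "d \<in> V" using d V by (simp add: span_eq_iff[THEN iffD2])
  have "a \<bullet> d = 0" if "a \<in> B" for a
  proof -
    have "a \<bullet> d = \<pi> a \<bullet> d"
      unfolding inner_vec_def using dV by (intro sum.cong) (auto simp: \<pi>_def V_def)
    also have "\<dots> = 0" using d(3)[of "\<pi> a"] that
      by (simp add: span_base orthogonal_def inner_commute)
    finally show ?thesis .
  qed
  then show ?thesis using d dV by (auto simp: V_def)
qed

text \<open>The number of zero residuals is at most \<open>l0 x - 2\<close>. Fixing them and the signed sum of
  the remaining ones imposes at most \<open>l0 x - 1\<close> linear conditions on the \<open>l0 x\<close> free
  coordinates.\<close>

lemma ex_direction_preserving_l0_l1:
  fixes A :: "real ^ 'n ^ 'm"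
  assumes "int (l0 (A *v x - b)) \<ge> int CARD('m) + 2 - int (l0 x)"
  shows "\<exists>d. d \<noteq> 0 \<and> (\<forall>\<^sub>F t in at_right 0. l0 (x + t *\<^sub>R d) = l0 x \<and>
           l1_norm (A *v (x + t *\<^sub>R d) - b) = l1_norm (A *v x - b))"
proof -
  define r where "r = A *v x - b"
  define Z where "Z = {i. r $ i = 0}"
  \<comment> \<open>\<open>v \<bullet> d\<close> is the derivative along \<open>d\<close> of the
    \<open>l1\<close> norm of the nonzero residuals; \<open>sgn 0 = 0\<close> drops the vanishing
    ones.\<close>
  define v where "v = (\<Sum>i\<in>UNIV. sgn (r $ i) *\<^sub>R A $ i)"
  have "card Z + card {i. r $ i \<noteq> 0} = CARD('m)"
    unfolding Z_def by (subst card_Un_disjoint[symmetric]) (auto intro: arg_cong[of _ _ card])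
  then have "card Z + 1 < l0 x" using assms unfolding l0_def r_def by linarith
  moreover have "card (insert v ((\<lambda>i. A $ i) ` Z)) \<le> card Z + 1"
    using card_insert_le_m1 card_image_le[of Z "\<lambda>i. A $ i"]
    by (simp add: card_insert_if le_SucI)
  ultimately have "card (insert v ((\<lambda>i. A $ i) ` Z)) < card {j. x $ j \<noteq> 0}"
    by (simp add: l0_def)
  then obtain d where d: "d \<noteq> 0" "\<And>j. x $ j = 0 \<Longrightarrow> d $ j = 0"
      "v \<bullet> d = 0" "\<And>i. i \<in> Z \<Longrightarrow> A $ i \<bullet> d = 0"
    using ex_orthogonal_in_coordinate_subspace[of "insert v ((\<lambda>i. A $ i) ` Z)" "{j. x $ j \<noteq> 0}"]
    by auto
  have row: "(A *v d) $ i = A $ i \<bullet> d" for i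
    by (simp add: matrix_vector_mul_component)
  have "(\<Sum>i\<in>UNIV. sgn (r $ i) * (A *v d) $ i) = v \<bullet> d"
    by (simp add: v_def inner_sum_left row)
  then have "\<forall>\<^sub>F t in at_right 0. l1_norm (r + t *\<^sub>R (A *v d)) = l1_norm r"
    using d by (intro eventually_l1_norm_add) (auto simp: row Z_def)
  moreover have "r + t *\<^sub>R (A *v d) = A *v (x + t *\<^sub>R d) - b" for t
    by (simp add: r_def matrix_vector_right_distrib matrix_vector_mult_scaleR)
  ultimately have "\<forall>\<^sub>F t in at_right 0. l1_norm (A *v (x + t *\<^sub>R d) - b) = l1_norm (A *v x - b)"
    unfolding r_def by simp
  with eventually_l0_add[OF d(2)] d(1) show ?thesis
    by (auto intro!: exI[of _ d] eventually_conj)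
qed

section \<open>The sequences of Iteration 1\<close>

text \<open>By monotonicity of \<open>\<phi>\<close>, a sparse vector of least \<open>l1\<close>
  residual also has least loss.\<close>

lemma loss_attained_sparse:
  fixes A :: "real ^ 'n ^ 'm"
  assumes "mono_on {0..} \<phi>"
  shows "\<exists>x. x \<in> argmin_set (loss A b \<phi>) {x. l0 x \<le> k}"
proof -
  have "A *v 0 \<in> (\<lambda>x. A *v x) ` {x. l0 x \<le> k}" by (intro imageI) simp
  from l1_distance_attained[OF closed_image_sparse this, of b]
  obtain x where "l0 x \<le> k" "\<And>y. l0 y \<le> k \<Longrightarrow> l1_norm (A *v x - b) \<le> l1_norm (A *v y - b)"
    by auto
  then have "x \<in> argmin_set (loss A b \<phi>) {x. l0 x \<le> k}"
    using mono_onD[OF assms] by (simp add: argmin_set_iff loss_def l1_norm_nonneg)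
  then show ?thesis ..
qed

context
  fixes A :: "real ^ 'n ^ 'm" and b :: "real ^ 'm" and \<phi> :: "real \<Rightarrow> real"
  assumes mono: "mono_on {0..} \<phi>"
begin

private abbreviation (input) "\<rho> \<equiv> rho A b \<phi>"
private abbreviation (input) "s \<equiv> s_it A b \<phi>"
private abbreviation (input) "L \<equiv> itL A b \<phi>"
private abbreviation (input) "K \<equiv> itK A b \<phi>"

lemma rho_0_le: "\<rho> 0 \<le> loss A b \<phi> x" and rho_0_attained: "\<exists>x. loss A b \<phi> x = \<rho> 0"
proof -
  \<comment> \<open>The unconstrained problem is the sparse one with bound
    \<open>CARD('n)\<close>.\<close>
  have "{x::real^'n. l0 x \<le> CARD('n)} = UNIV" by (auto simp: l0_def card_mono)
  then obtain y where y: "y \<in> argmin_set (loss A b \<phi>) UNIV"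
    using loss_attained_sparse[OF mono, of A b "CARD('n)"] by auto
  then show "\<rho> 0 \<le> loss A b \<phi> x" "\<exists>x. loss A b \<phi> x = \<rho> 0"
    using min_value_eq[OF y] by (auto simp: argmin_set_iff)
qed

lemma rho_Suc: "\<rho> (Suc i) = min_value (loss A b \<phi>) {x. l0 x \<le> s i - 1}"
  by (simp add: s_it_def)

lemma rho_Suc_le: "l0 x \<le> s i - 1 \<Longrightarrow> \<rho> (Suc i) \<le> loss A b \<phi> x"
  and rho_Suc_attained: "\<exists>x. l0 x \<le> s i - 1 \<and> loss A b \<phi> x = \<rho> (Suc i)"
proof -
  obtain y where y: "y \<in> argmin_set (loss A b \<phi>) {x. l0 x \<le> s i - 1}"
    using loss_attained_sparse[OF mono] by blast
  show "l0 x \<le> s i - 1 \<Longrightarrow> \<rho> (Suc i) \<le> loss A b \<phi> x"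
    and "\<exists>x. l0 x \<le> s i - 1 \<and> loss A b \<phi> x = \<rho> (Suc i)"
    using y unfolding rho_Suc min_value_eq[OF y] by (auto simp: argmin_set_iff)
qed

lemma Omega_nonempty: "Omega A b \<phi> i \<noteq> {}"
proof -
  have "level_set A b \<phi> (\<rho> i) \<noteq> {}"
    using rho_0_attained rho_Suc_attained by (cases i) (auto simp: level_set_def simp del: rho.simps)
  then show ?thesis unfolding Omega_def by (rule argmin_set_nat_nonempty)
qed

lemma in_Omega:
  assumes "x \<in> Omega A b \<phi> i"
  shows "loss A b \<phi> x = \<rho> i" "l0 x = s i"
  using assms min_value_eq[of x l0 "level_set A b \<phi> (\<rho> i)"]
  by (auto simp: Omega_def argmin_set_iff level_set_def s_it_def)

lemma s_le: "loss A b \<phi> x = \<rho> i \<Longrightarrow> s i \<le> l0 x"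
proof -
  assume *: "loss A b \<phi> x = \<rho> i"
  obtain y where y: "y \<in> Omega A b \<phi> i" using Omega_nonempty by blast
  with * have "l0 y \<le> l0 x" by (auto simp: Omega_def argmin_set_iff level_set_def)
  then show ?thesis using in_Omega[OF y] by simp
qed

text \<open>A point attaining \<open>\<rho> (Suc i)\<close> under the sparsity bound lies on the
  level set that defines \<open>s (Suc i)\<close>.\<close>

lemma s_Suc_le: "s (Suc i) \<le> s i - 1"
  using rho_Suc_attained[of i] s_le by fastforce

text \<open>Since \<open>s\<close> decreases, the bound \<open>s i\<close> is at least as strict as
  the one in the definition of \<open>\<rho> i\<close>.\<close>

lemma rho_le: "l0 x \<le> s i \<Longrightarrow> \<rho> i \<le> loss A b \<phi> x"
  using rho_0_le rho_Suc_le s_Suc_le by (cases i) (blast intro: order_trans)+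

lemma rho_less_Suc:
  assumes "s i > 0"
  shows "\<rho> i < \<rho> (Suc i)"
proof -
  obtain x where x: "l0 x \<le> s i - 1" "loss A b \<phi> x = \<rho> (Suc i)" using rho_Suc_attained by blast
  then have "\<rho> i \<le> \<rho> (Suc i)" using rho_le[of x i] by (simp del: rho.simps)
  \<comment> \<open>Equality would put a point with fewer than \<open>s i\<close> nonzeros on the
    level set of \<open>\<rho> i\<close>.\<close>
  moreover have "\<rho> i \<noteq> \<rho> (Suc i)" using s_le[of x i] x assms by (auto simp del: rho.simps)
  ultimately show ?thesis by (simp del: rho.simps)
qed

lemma s_itL: "s L = 0"
proof -
  \<comment> \<open>Each step lowers \<open>s\<close> by at least one until it is zero, so the index
    \<open>s 0\<close> is certain to reach zero.\<close>
  have "s i \<le> s 0 - i" for i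
  proof (induction i)
    case (Suc i)
    then show ?case using s_Suc_le[of i] by linarith
  qed simp
  then have "s (s 0) = 0" by (metis diff_self_eq_0 le_zero_eq)
  then show ?thesis unfolding itL_def by (rule LeastI)
qed

lemma s_pos: "i < L \<Longrightarrow> s i > 0"
  unfolding itL_def using not_less_Least by blast

lemma rho_less:
  assumes "i < j" "j \<le> L"
  shows "\<rho> i < \<rho> j"
  using assms
proof (induction j)
  case (Suc j)
  then have "\<rho> j < \<rho> (Suc j)" by (intro rho_less_Suc s_pos) simp
  with Suc show ?case by (cases "i = j") (auto simp del: rho.simps)
qed simp

lemma loss_zero: "loss A b \<phi> 0 = \<rho> L"
proof -
  obtain y where y: "y \<in> Omega A b \<phi> L" using Omega_nonempty by blast
  from in_Omega[OF y] s_itL have "y = 0" by simp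
  with in_Omega[OF y] show ?thesis by simp
qed

text \<open>This reduces minimization over all vectors to finitely many pairs
  \<open>(\<rho> j, s j)\<close>. For the least \<open>j\<close> with \<open>s j \<le> l0 x\<close>,
  minimality makes \<open>x\<close> admissible in the problem defining
  \<open>\<rho> j\<close>.\<close>

lemma ex_dominating_index: "\<exists>j\<le>L. s j \<le> l0 x \<and> \<rho> j \<le> loss A b \<phi> x"
proof -
  define j where "j = (LEAST j. s j \<le> l0 x)"
  have L: "s L \<le> l0 x" using s_itL by simp
  have j: "j \<le> L" "s j \<le> l0 x" unfolding j_def using L by (auto intro: Least_le LeastI)
  have "\<rho> j \<le> loss A b \<phi> x"
  proof (cases j)
    case 0
    then show ?thesis using rho_0_le by simp
  next
    case (Suc i)
    then have "l0 x < s i" using not_less_Least[of i "\<lambda>j. s j \<le> l0 x"] by (simp add: j_def)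
    then show ?thesis unfolding Suc by (intro rho_Suc_le) simp
  qed
  with j show ?thesis by blast
qed

section \<open>The sequences of Iteration 2\<close>

private abbreviation (input) "T i \<equiv> Max (Lam A b \<phi> i)"

text \<open>The bound \<open>i \<le> T i\<close> serves termination: the maxima increase strictly
  until \<open>L\<close> is reached.\<close>

lemma Lam_range:
  assumes "\<And>j. j < i \<Longrightarrow> L \<notin> Lam A b \<phi> j"
  shows "Lam A b \<phi> i \<subseteq> {..L} \<and> Lam A b \<phi> i \<noteq> {} \<and> i \<le> T i"
  using assms
proof (induction i)
  case (Suc i)
  then have IH: "Lam A b \<phi> i \<subseteq> {..L}" "Lam A b \<phi> i \<noteq> {}" "i \<le> T i" by auto
  then have "T i \<in> Lam A b \<phi> i" by (meson Max_in finite_atMost finite_subset)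
  with IH Suc.prems[of i] have "T i < L" by (metis atMost_iff lessI nat_less_le subsetD)
  then have ne: "Lam A b \<phi> (Suc i) \<noteq> {}" by (simp add: argmax_set_finite_nonempty)
  have sub: "Lam A b \<phi> (Suc i) \<subseteq> {T i + 1..L}" by (auto simp: argmax_set_iff)
  then have "T (Suc i) \<in> {T i + 1..L}"
    using ne by (meson Max_in finite_atLeastAtMost finite_subset subsetD)
  then show ?case using ne sub IH by auto
qed auto

lemma itL_in_Lam_itK: "L \<in> Lam A b \<phi> K"
proof -
  have "\<exists>i. L \<in> Lam A b \<phi> i"
  proof (rule ccontr)
    assume "\<nexists>i. L \<in> Lam A b \<phi> i"
    \<comment> \<open>After \<open>Suc L\<close> rounds the maximum would exceed
      \<open>L\<close>.\<close>
    then have "Lam A b \<phi> (Suc L) \<subseteq> {..L} \<and> Lam A b \<phi> (Suc L) \<noteq> {} \<and> Suc L \<le> T (Suc L)"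
      by (intro Lam_range) auto
    moreover from this have "T (Suc L) \<in> {..L}"
      by (meson Max_in finite_atMost finite_subset subsetD)
    ultimately show False by auto
  qed
  then show ?thesis unfolding itK_def by (rule LeastI_ex)
qed

lemma itL_notin_Lam: "i < K \<Longrightarrow> L \<notin> Lam A b \<phi> i"
  unfolding itK_def using not_less_Least by blast

lemma Lam_before:
  assumes "i \<le> K"
  shows "Lam A b \<phi> i \<subseteq> {..L}" "finite (Lam A b \<phi> i)" "T i \<in> Lam A b \<phi> i" "T i \<le> L"
proof -
  have *: "Lam A b \<phi> i \<subseteq> {..L} \<and> Lam A b \<phi> i \<noteq> {} \<and> i \<le> T i"
    using assms itL_notin_Lam by (intro Lam_range) auto
  then show "Lam A b \<phi> i \<subseteq> {..L}" by blast
  then show fin: "finite (Lam A b \<phi> i)" using finite_subset by blast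
  then show "T i \<in> Lam A b \<phi> i" using * by simp
  then show "T i \<le> L" using * by auto
qed

text \<open>At \<open>i = K\<close> the two branches agree, because \<open>L\<close> is the largest
  element of the last set.\<close>

lemma t_it_eq: "i \<le> K \<Longrightarrow> t_it A b \<phi> i = T i"
  using Lam_before[of K] itL_in_Lam_itK
  by (auto simp: t_it_def dest!: le_neq_implies_less intro!: antisym)

lemma T_less: "i < K \<Longrightarrow> T i < L"
  using Lam_before[of i] itL_notin_Lam by (metis le_less less_imp_le_nat)

lemma T_Suc: "i < K \<Longrightarrow> T (Suc i) \<in> argmax_set (ratio A b \<phi> (T i)) {T i + 1..L}"
  using Lam_before(3)[of "Suc i"] by simp

text \<open>\<open>\<Lambda> i\<close> is the number \<open>\<lambda>\<close> of the paper with index \<open>i\<close>, not the index set \<open>\<Lambda>\<close>,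
  which is \<open>Lam\<close>.\<close>

private abbreviation (input) "\<Lambda> i \<equiv> ratio A b \<phi> (T i) (T (Suc i))"

lemma lam_eq: "i < K \<Longrightarrow> lam A b \<phi> (int i) = ereal (\<Lambda> i)"
proof -
  assume i: "i < K"
  have "Max (ratio A b \<phi> (T i) ` {T i + 1..L}) = \<Lambda> i"
    using T_Suc[OF i] by (intro Max_eqI) (auto simp: argmax_set_iff)
  then show ?thesis using i by (simp add: lam_def t_it_eq)
qed

text \<open>Pairs to the right of vertex \<open>i\<close> lie on or above the line of slope
  \<open>- \<Lambda> i\<close> through it; this is maximality of the ratio with the positive
  denominator cleared.\<close>

lemma slope_after:
  assumes "i < K" "T i < j" "j \<le> L"
  shows "real (s (T i)) - real (s j) \<le> \<Lambda> i * (\<rho> j - \<rho> (T i))"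
proof -
  have "ratio A b \<phi> (T i) j \<le> \<Lambda> i" using T_Suc[OF assms(1)] assms by (auto simp: argmax_set_iff)
  then show ?thesis using rho_less[OF assms(2,3)] by (simp add: ratio_def pos_divide_le_eq)
qed

lemma slope_step:
  assumes "i < K"
  shows "T i < T (Suc i)" "T (Suc i) \<le> L"
    "real (s (T i)) - real (s (T (Suc i))) = \<Lambda> i * (\<rho> (T (Suc i)) - \<rho> (T i))"
proof -
  show *: "T i < T (Suc i)" "T (Suc i) \<le> L" using T_Suc[OF assms] by (auto simp: argmax_set_iff)
  show "real (s (T i)) - real (s (T (Suc i))) = \<Lambda> i * (\<rho> (T (Suc i)) - \<rho> (T i))"
    using rho_less[OF *] by (simp add: ratio_def)
qed

text \<open>Convexity of the hull: vertex \<open>i + 2\<close> lies on or above the line through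
  vertices \<open>i\<close> and \<open>i + 1\<close>. Subtracting the equation of that line at
  vertex \<open>i + 1\<close> compares the two slopes.\<close>

lemma slope_decreasing:
  assumes "Suc i < K"
  shows "\<Lambda> (Suc i) \<le> \<Lambda> i"
proof -
  note st = slope_step[OF assms]
  have i: "i < K" using assms by simp
  note st' = slope_step[OF i]
  have "real (s (T i)) - real (s (T (Suc (Suc i)))) \<le> \<Lambda> i * (\<rho> (T (Suc (Suc i))) - \<rho> (T i))"
    using i st st' by (intro slope_after) auto
  with st'(3) st(3) have "\<Lambda> (Suc i) * (\<rho> (T (Suc (Suc i))) - \<rho> (T (Suc i)))
      \<le> \<Lambda> i * (\<rho> (T (Suc (Suc i))) - \<rho> (T (Suc i)))"
    by (simp add: algebra_simps del: Lam.simps)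
  then show ?thesis using rho_less[OF st(1,2)] by (simp del: Lam.simps)
qed

text \<open>The hull line, extended to the left, stays below all earlier pairs. Those left of the
  previous vertex inherit this from the previous line, which is at least as steep; the others are
  covered by \<open>slope_after\<close>.\<close>

lemma slope_before:
  assumes "i < K" "j < T (Suc i)"
  shows "real (s j) - real (s (T (Suc i))) \<ge> \<Lambda> i * (\<rho> (T (Suc i)) - \<rho> j)"
  using assms
proof (induction i)
  case 0
  \<comment> \<open>As \<open>T 0 = 0\<close>, \<open>j\<close> is the left vertex or lies within
    the first segment.\<close>
  then show ?case using slope_step[of 0] slope_after[of 0 j]
    by (cases "j = 0") (auto simp: algebra_simps simp del: Lam.simps(2) rho.simps)
next
  case (Suc i)
  note st = slope_step[OF Suc.prems(1)]
  consider "j < T (Suc i)" | "j = T (Suc i)" | "j > T (Suc i)" by linarith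
  then show ?case
  proof cases
    case 1
    have "\<Lambda> (Suc i) * (\<rho> (T (Suc i)) - \<rho> j) \<le> \<Lambda> i * (\<rho> (T (Suc i)) - \<rho> j)"
      using slope_decreasing[OF Suc.prems(1)] rho_less[OF 1] st
      by (intro mult_right_mono) (auto simp del: Lam.simps)
    also have "\<dots> \<le> real (s j) - real (s (T (Suc i)))" using Suc 1 by simp
    finally show ?thesis using st(3) by (simp add: algebra_simps del: Lam.simps)
  next
    case 2
    then show ?thesis using st(3) by (simp del: Lam.simps)
  next
    case 3
    then have "real (s (T (Suc i))) - real (s j) \<le> \<Lambda> (Suc i) * (\<rho> j - \<rho> (T (Suc i)))"
      using Suc.prems st by (intro slope_after) (auto simp del: Lam.simps)
    then show ?thesis using st(3) by (simp add: algebra_simps del: Lam.simps)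
  qed
qed

section \<open>Solutions of the penalized and the constrained problem\<close>

text \<open>The zero vector realizes the last vertex. For \<open>\<mu>\<close> below the last slope,
  moving left gains less in loss than it costs in sparsity.\<close>

lemma P_sol_zero:
  assumes "\<mu> > 0" "ereal \<mu> < lam A b \<phi> (int K - 1)"
  shows "P_sol A b \<phi> \<mu> = {0}"
proof -
  have strict: "P_obj A b \<phi> \<mu> 0 < P_obj A b \<phi> \<mu> x" if "x \<noteq> 0" for x
  proof -
    obtain j where j: "j \<le> L" "s j \<le> l0 x" "\<rho> j \<le> loss A b \<phi> x" using ex_dominating_index by blast
    have le: "\<mu> * \<rho> j \<le> \<mu> * loss A b \<phi> x" using j assms by simp
    show ?thesis
    proof (cases "j = L")
      case True
      have "l0 x > 0" using that by (metis l0_eq_0_iff neq0_conv)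
      then show ?thesis using le True by (simp add: P_obj_def loss_zero)
    next
      case False
      then have "j < L" using j by simp
      \<comment> \<open>\<open>K = 0\<close> would mean \<open>L = 0\<close>, leaving no index below
        \<open>L\<close>.\<close>
      have "K \<noteq> 0" using False itL_in_Lam_itK j by (auto intro: gr0I)
      then obtain i where i: "K = Suc i" using not0_implies_Suc by blast
      have TL: "T (Suc i) = L"
        using Lam_before[of K] itL_in_Lam_itK i by (metis Max_ge antisym order_refl)
      have "\<mu> < \<Lambda> i" using assms(2) i lam_eq[of i] by simp
      then have "\<mu> * (\<rho> L - \<rho> j) < \<Lambda> i * (\<rho> L - \<rho> j)"
        using rho_less[OF \<open>j < L\<close>] by simp
      also have "\<dots> \<le> real (s j)" using slope_before[of i j] i \<open>j < L\<close> s_itL unfolding TL by simp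
      finally show ?thesis using le j(2) by (simp add: P_obj_def loss_zero algebra_simps)
    qed
  qed
  then have "P_obj A b \<phi> \<mu> 0 \<le> P_obj A b \<phi> \<mu> x" for x by (cases "x = 0") (auto intro: less_imp_le)
  moreover have "x = 0" if "x \<in> P_sol A b \<phi> \<mu>" for x
    using that strict[of x] by (metis P_sol_def UNIV_I argmin_set_iff not_le)
  ultimately show ?thesis by (auto simp: P_sol_def argmin_set_iff)
qed

text \<open>For \<open>\<mu>\<close> between consecutive slopes, the line of slope
  \<open>- \<mu>\<close> through vertex \<open>k\<close> supports the whole front; domination
  extends this to all vectors.\<close>

lemma Omega_subset_P_sol:
  assumes k: "k < K" and \<mu>: "lam A b \<phi> (int k) \<le> ereal \<mu>" "ereal \<mu> < lam A b \<phi> (int k - 1)"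
  shows "Omega A b \<phi> (t_it A b \<phi> k) \<subseteq> P_sol A b \<phi> \<mu>"
proof
  fix x assume "x \<in> Omega A b \<phi> (t_it A b \<phi> k)"
  then have x: "loss A b \<phi> x = \<rho> (T k)" "l0 x = s (T k)"
    using in_Omega k by (auto simp: t_it_eq)
  have \<mu>k: "\<Lambda> k \<le> \<mu>" using \<mu>(1) lam_eq[OF k] by simp
  \<comment> \<open>Nonnegativity of \<open>\<mu>\<close> is what lets dominated vectors be
    discarded; it comes from the ratio towards \<open>L\<close>, where \<open>s\<close>
    vanishes.\<close>
  have "0 \<le> ratio A b \<phi> (T k) L"
    using rho_less[OF T_less[OF k]] s_itL by (simp add: ratio_def)
  also have "\<dots> \<le> \<Lambda> k" using T_Suc[OF k] T_less[OF k] by (auto simp: argmax_set_iff)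
  finally have "\<mu> \<ge> 0" using \<mu>k by simp
  have vertex: "real (s (T k)) + \<mu> * \<rho> (T k) \<le> real (s j) + \<mu> * \<rho> j" if "j \<le> L" for j
  proof -
    consider "j < T k" | "j = T k" | "j > T k" by linarith
    then show ?thesis
    proof cases
      case 1
      \<comment> \<open>\<open>k = 0\<close> is impossible here, since nothing precedes
        \<open>T 0 = 0\<close>.\<close>
      then obtain i where i: "k = Suc i" by (cases k) auto
      have "\<mu> < \<Lambda> i" using \<mu>(2) i k lam_eq[of i] by simp
      then have "\<mu> * (\<rho> (T k) - \<rho> j) \<le> \<Lambda> i * (\<rho> (T k) - \<rho> j)"
        using rho_less[OF 1] T_less[OF k] by (intro mult_right_mono) auto
      also have "\<dots> \<le> real (s j) - real (s (T k))"
        using slope_before[of i j] i k 1 by (simp del: Lam.simps)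
      finally show ?thesis by (simp add: algebra_simps)
    next
      case 3
      have "real (s (T k)) - real (s j) \<le> \<Lambda> k * (\<rho> j - \<rho> (T k))"
        using k 3 that by (rule slope_after)
      also have "\<dots> \<le> \<mu> * (\<rho> j - \<rho> (T k))"
        using \<mu>k rho_less[OF 3 that] by (intro mult_right_mono) auto
      finally show ?thesis by (simp add: algebra_simps)
    qed simp
  qed
  have "P_obj A b \<phi> \<mu> x \<le> P_obj A b \<phi> \<mu> y" for y
  proof -
    obtain j where j: "j \<le> L" "s j \<le> l0 y" "\<rho> j \<le> loss A b \<phi> y" using ex_dominating_index by blast
    have "P_obj A b \<phi> \<mu> x \<le> real (s j) + \<mu> * \<rho> j" using vertex[OF j(1)] by (simp add: P_obj_def x)
    also have "\<dots> \<le> P_obj A b \<phi> \<mu> y"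
      unfolding P_obj_def using j \<open>\<mu> \<ge> 0\<close> by (intro add_mono mult_left_mono) auto
    finally show ?thesis .
  qed
  then show "x \<in> P_sol A b \<phi> \<mu>" by (simp add: P_sol_def argmin_set_iff)
qed

section \<open>The constrained problem when \<open>\<phi>\<close> is the identity on nonnegative
  reals\<close>

context
  assumes ident: "\<forall>z\<ge>0. \<phi> z = z"
begin

lemma loss_ident: "loss A b \<phi> x = l1_norm (A *v x - b)"
  using ident by (simp add: loss_def l1_norm_nonneg)

text \<open>A feasible vector with fewer than \<open>s k\<close> nonzeros would have loss at least
  \<open>\<rho> (Suc k) > \<sigma>\<close>, while points of \<open>Omega\<close> with index
  \<open>k\<close> are feasible.\<close>

lemma C_sol_eq:
  assumes "s k > 0" "\<rho> k \<le> \<sigma>" "\<sigma> < \<rho> (Suc k)"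
  shows "C_sol A b \<sigma> = {x \<in> C_feas A b \<sigma>. l0 x = s k}"
proof -
  have ge: "s k \<le> l0 y" if "y \<in> C_feas A b \<sigma>" for y
    using that assms rho_Suc_le[of y k] by (force simp: C_feas_def loss_ident simp del: rho.simps)
  obtain z where z: "z \<in> Omega A b \<phi> k" using Omega_nonempty by blast
  then have "z \<in> C_feas A b \<sigma>" "l0 z = s k"
    using in_Omega[OF z] assms by (auto simp: C_feas_def loss_ident)
  with ge show ?thesis by (force simp: C_sol_def argmin_set_iff)
qed

text \<open>The constraint has slack at a point \<open>x\<close> of \<open>Omega\<close>, so scaling
  \<open>x\<close> by \<open>1 + t\<close> stays feasible by continuity and keeps its
  support.\<close>

lemma infinite_C_sol_between:
  assumes "k < L" "\<rho> k < \<sigma>" "\<sigma> < \<rho> (Suc k)"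
  shows "infinite (C_sol A b \<sigma>)"
proof -
  obtain x where x: "x \<in> Omega A b \<phi> k" using Omega_nonempty by blast
  note x = in_Omega[OF x]
  have "x \<noteq> 0" using x s_pos[OF assms(1)] by auto
  have "((\<lambda>t. l1_norm (A *v x + t *\<^sub>R (A *v x) - b)) \<longlongrightarrow>
      l1_norm (A *v x + 0 *\<^sub>R (A *v x) - b)) (at_right 0)"
    unfolding l1_norm_def by (intro tendsto_intros)
  then have "((\<lambda>t. l1_norm (A *v (x + t *\<^sub>R x) - b)) \<longlongrightarrow> \<rho> k) (at_right 0)"
    using x by (simp add: loss_ident matrix_vector_right_distrib matrix_vector_mult_scaleR)
  then have "\<forall>\<^sub>F t in at_right 0. l1_norm (A *v (x + t *\<^sub>R x) - b) < \<sigma>"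
    using assms(2) by (rule order_tendstoD)
  moreover have "\<forall>\<^sub>F t in at_right 0. l0 (x + t *\<^sub>R x) = l0 x" by (rule eventually_l0_add)
  ultimately have "\<forall>\<^sub>F t in at_right 0. x + t *\<^sub>R x \<in> C_sol A b \<sigma>"
    unfolding C_sol_eq[OF s_pos[OF assms(1)] less_imp_le[OF assms(2)] assms(3)]
    by eventually_elim (simp add: C_feas_def x)
  then show ?thesis using infinite_ray(1)[OF \<open>x \<noteq> 0\<close>] by blast
qed

text \<open>Here the constraint is tight, so the direction must preserve the residual norm
  exactly.\<close>

lemma C_sol_perturb:
  assumes "x \<in> Omega A b \<phi> k" "int (l0 (A *v x - b)) \<ge> int CARD('m) + 2 - int (s k)"
  shows "infinite (C_sol A b (\<rho> k))" "\<not> strict_minimizer (\<lambda>x. real (l0 x)) (C_feas A b (\<rho> k)) x"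
proof -
  note x = in_Omega[OF assms(1)]
  obtain d where d: "d \<noteq> 0" and ev: "\<forall>\<^sub>F t in at_right 0. l0 (x + t *\<^sub>R d) = l0 x \<and>
      l1_norm (A *v (x + t *\<^sub>R d) - b) = l1_norm (A *v x - b)"
    using ex_direction_preserving_l0_l1[of x A b] assms x by auto
  \<comment> \<open>A residual has at most \<open>CARD('m)\<close> nonzeros, so the assumed bound
    forces \<open>s k \<ge> 2\<close>.\<close>
  have "l0 (A *v x - b) \<le> CARD('m)" by (simp add: l0_def card_mono)
  then have "s k > 0" using assms(2) by linarith
  then have sol: "C_sol A b (\<rho> k) = {y \<in> C_feas A b (\<rho> k). l0 y = s k}"
    using C_sol_eq rho_less_Suc by blast
  have ev': "\<forall>\<^sub>F t in at_right 0. x + t *\<^sub>R d \<in> C_sol A b (\<rho> k)"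
    unfolding sol using ev by (rule eventually_mono) (use x in \<open>simp add: C_feas_def loss_ident\<close>)
  show "infinite (C_sol A b (\<rho> k))" using infinite_ray(1)[OF d ev'] .
  show "\<not> strict_minimizer (\<lambda>x. real (l0 x)) (C_feas A b (\<rho> k)) x"
    using ev' x by (intro not_strict_minimizer_ray[OF d]) (auto simp: sol elim: eventually_mono)
qed

end

end

lemma P_sol_perturb:
  fixes A :: "real ^ 'n ^ 'm"
  assumes "x \<in> P_sol A b \<phi> \<mu>" "int (l0 (A *v x - b)) \<ge> int CARD('m) + 2 - int (l0 x)"
  shows "infinite (P_sol A b \<phi> \<mu>)" "\<not> strict_minimizer (P_obj A b \<phi> \<mu>) UNIV x"
proof -
  obtain d where d: "d \<noteq> 0" and ev: "\<forall>\<^sub>F t in at_right 0. l0 (x + t *\<^sub>R d) = l0 x \<and>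
      l1_norm (A *v (x + t *\<^sub>R d) - b) = l1_norm (A *v x - b)"
    using ex_direction_preserving_l0_l1[OF assms(2)] by blast
  have ev': "\<forall>\<^sub>F t in at_right 0. x + t *\<^sub>R d \<in> P_sol A b \<phi> \<mu>"
    using ev by (rule eventually_mono)
      (use assms(1) in \<open>simp add: P_sol_def argmin_set_iff P_obj_def loss_def\<close>)
  show "infinite (P_sol A b \<phi> \<mu>)" using infinite_ray(1)[OF d ev'] .
  show "\<not> strict_minimizer (P_obj A b \<phi> \<mu>) UNIV x"
    using ev
    by (intro not_strict_minimizer_ray[OF d]) (auto simp: P_obj_def loss_def elim: eventually_mono)
qed

lemma C_sol_zero:
  assumes "\<sigma> \<ge> l1_norm b"
  shows "C_sol A b \<sigma> = {0}"
proof -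
  have "l1_norm (- b) = l1_norm b" by (simp add: l1_norm_def)
  then have "0 \<in> C_feas A b \<sigma>" using assms by (simp add: C_feas_def)
  then show ?thesis by (force simp: C_sol_def argmin_set_iff)
qed

theorem theorem6p11:
  fixes A :: "real ^ 'n ^ 'm" and b :: "real ^ 'm" and \<phi> :: "real \<Rightarrow> real"
  assumes phi_range: "\<phi> \<in> {0..} \<rightarrow> {0..}"
    and phi_cont: "continuous_on {0..} \<phi>"
    and phi_mono: "mono_on {0..} \<phi>"
    and phi_zero: "\<phi> 0 = 0"
  shows
    "((\<forall>\<sigma>. \<sigma> \<ge> l1_norm b \<longrightarrow> C_sol A b \<sigma> = {0})
      \<and> (\<forall>\<mu>. 0 < \<mu> \<and> ereal \<mu> < lam A b \<phi> (int (itK A b \<phi>) - 1) \<longrightarrow> P_sol A b \<phi> \<mu> = {0}))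
   \<and> (\<forall>k xs. (k + 1 = itK A b \<phi> \<and> s_it A b \<phi> (t_it A b \<phi> k) \<ge> 2 \<or> k + 2 \<le> itK A b \<phi>) \<longrightarrow>
        xs \<in> Omega A b \<phi> (t_it A b \<phi> k) \<longrightarrow>
        int (l0 (A *v xs - b)) \<ge> int CARD('m) + 2 - int (s_it A b \<phi> (t_it A b \<phi> k)) \<longrightarrow>
        (\<forall>\<mu>. lam A b \<phi> (int k) \<le> ereal \<mu> \<and> ereal \<mu> < lam A b \<phi> (int k - 1) \<longrightarrow>
           infinite (P_sol A b \<phi> \<mu>) \<and> \<not> strict_minimizer (P_obj A b \<phi> \<mu>) UNIV xs))
   \<and> ((\<forall>z\<ge>0. \<phi> z = z) \<longrightarrow>
        (\<forall>k \<sigma>. k < itL A b \<phi> \<and> rho A b \<phi> k < \<sigma> \<and> \<sigma> < rho A b \<phi> (k + 1) \<longrightarrow>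
           infinite (C_sol A b \<sigma>))
      \<and> (\<forall>k xs. (k + 1 = itK A b \<phi> \<and> s_it A b \<phi> k \<ge> 2 \<or> k + 2 \<le> itK A b \<phi>) \<longrightarrow>
           xs \<in> Omega A b \<phi> k \<longrightarrow>
           int (l0 (A *v xs - b)) \<ge> int CARD('m) + 2 - int (s_it A b \<phi> k) \<longrightarrow>
           infinite (C_sol A b (rho A b \<phi> k)) \<and>
           \<not> strict_minimizer (\<lambda>x. real (l0 x)) (C_feas A b (rho A b \<phi> k)) xs))"
proof (intro conjI allI impI; (elim conjE)?)
  show "C_sol A b \<sigma> = {0}" if "\<sigma> \<ge> l1_norm b" for \<sigma>
    using that by (rule C_sol_zero)
  show "P_sol A b \<phi> \<mu> = {0}" if "0 < \<mu>" "ereal \<mu> < lam A b \<phi> (int (itK A b \<phi>) - 1)" for \<mu>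
    using phi_mono that by (rule P_sol_zero)
next
  fix k xs \<mu>
  assume k: "k + 1 = itK A b \<phi> \<and> s_it A b \<phi> (t_it A b \<phi> k) \<ge> 2 \<or> k + 2 \<le> itK A b \<phi>"
    and xs: "xs \<in> Omega A b \<phi> (t_it A b \<phi> k)"
    and res: "int (l0 (A *v xs - b)) \<ge> int CARD('m) + 2 - int (s_it A b \<phi> (t_it A b \<phi> k))"
    and \<mu>: "lam A b \<phi> (int k) \<le> ereal \<mu>" "ereal \<mu> < lam A b \<phi> (int k - 1)"
  \<comment> \<open>Both alternatives place \<open>k\<close> before the last vertex, so
    \<open>lam\<close> at \<open>k\<close> is a genuine slope.\<close>
  have "k < itK A b \<phi>" using k by auto
  then have "xs \<in> P_sol A b \<phi> \<mu>" using Omega_subset_P_sol[OF phi_mono _ \<mu>] xs by blast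
  moreover have "int (l0 (A *v xs - b)) \<ge> int CARD('m) + 2 - int (l0 xs)"
    using res in_Omega(2)[OF phi_mono xs] by simp
  ultimately show "infinite (P_sol A b \<phi> \<mu>)" "\<not> strict_minimizer (P_obj A b \<phi> \<mu>) UNIV xs"
    by (rule P_sol_perturb)+
next
  assume ident: "\<forall>z\<ge>0. \<phi> z = z"
  show "infinite (C_sol A b \<sigma>)"
    if "k < itL A b \<phi>" "rho A b \<phi> k < \<sigma>" "\<sigma> < rho A b \<phi> (k + 1)" for k \<sigma>
    using infinite_C_sol_between[OF phi_mono ident] that by (simp del: rho.simps)
  fix k xs
  assume "xs \<in> Omega A b \<phi> k"
    and "int (l0 (A *v xs - b)) \<ge> int CARD('m) + 2 - int (s_it A b \<phi> k)"
  then show "infinite (C_sol A b (rho A b \<phi> k))"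
    "\<not> strict_minimizer (\<lambda>x. real (l0 x)) (C_feas A b (rho A b \<phi> k)) xs"
    by (rule C_sol_perturb[OF phi_mono ident])+
qed

end
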